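(* If $K=U(\mathrm{Lip}\,1)$ on $\Omega:=[0,1]$ and $\Sigma:=(\Sigma_n)_{n\ge1}$ with $\Sigma_n:=\Upsilon^{11,16n+2}(\mathrm{ReLU};1,1)$, $n\ge1$, then we have $$E(K,\Sigma_n)_{C(\Omega)}\le6n^{-2},\quad n\ge1.$$
   Context: $\mathrm{Lip}\,1$ on $\Omega=[0,1]$ is the space of continuous functions $f$ with $|f(x)-f(y)|\le M|x-y|$, $x,y\in\Omega$, for some $M$; the smallest such $M$ is the seminorm $|f|_{\mathrm{Lip}\,1}$, the norm is $|f|_{\mathrm{Lip}\,1}+\|f\|_{C(\Omega)}$, and $U(\mathrm{Lip}\,1)$ is the unit ball. $\|\cdot\|_{C(\Omega)}$ is the supremum norm, and $E(K,\Sigma_n)_{C(\Omega)}:=\sup_{f\in K}\inf_{g\in\Sigma_n}\|f-g\|_{C(\Omega)}$. For $W,L\ge1$, $\Upsilon^{W,L}(\mathrm{ReLU};1,1)$ denotes the set of all functions $\mathbb R\to\mathbb R$ that are outputs of fully connected ReLU networks with $L$ hidden layers each of width $W$, i.e. functions $x\mapsto W^{(L+1)}X^{(L)}+b^{(L+1)}$, where $X^{(0)}=x$ and $X^{(\ell)}=\mathrm{ReLU}(W^{(\ell)}X^{(\ell-1)}+b^{(\ell)})$ for $\ell=1,\dots,L$, with arbitrary real matrices $W^{(\ell)}$ and vectors $b^{(\ell)}$ of the appropriate sizes, and $\mathrm{ReLU}(t)=\max\{0,t\}$ acting coordinatewise. *)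

theory Defs
  imports
    "HOL-Analysis.Lipschitz"
    "HOL-Library.Extended_Real"
    "Jordan_Normal_Form.Matrix"
begin

text \<open>
  Functions on a set \<open>\<Omega>\<close> of reals are represented by functions of type \<open>real \<Rightarrow> real\<close>;
  all notions below depend on the values on \<open>\<Omega>\<close> only.
  The supremum norm is meant for functions that are bounded on \<open>\<Omega>\<close> and for \<open>\<Omega>\<close> nonempty.
\<close>

definition sup_norm :: "real set \<Rightarrow> (real \<Rightarrow> real) \<Rightarrow> real" where
  "sup_norm \<Omega> f = (SUP x\<in>\<Omega>. \<bar>f x\<bar>)"

definition lip1 :: "real set \<Rightarrow> (real \<Rightarrow> real) set" where
  "lip1 \<Omega> = {f. continuous_on \<Omega> f \<and> (\<exists>M. M-lipschitz_on \<Omega> f)}"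

text \<open>The infimum over the admissible constants is attained, so it is the smallest one.\<close>

definition lip1_seminorm :: "real set \<Rightarrow> (real \<Rightarrow> real) \<Rightarrow> real" where
  "lip1_seminorm \<Omega> f = Inf {M. M-lipschitz_on \<Omega> f}"

definition lip1_norm :: "real set \<Rightarrow> (real \<Rightarrow> real) \<Rightarrow> real" where
  "lip1_norm \<Omega> f = lip1_seminorm \<Omega> f + sup_norm \<Omega> f"

definition lip1_unit_ball :: "real set \<Rightarrow> (real \<Rightarrow> real) set" where
  "lip1_unit_ball \<Omega> = {f \<in> lip1 \<Omega>. lip1_norm \<Omega> f \<le> 1}"

text \<open>
  The worst-case approximation error takes values in the extended reals, so that the
  supremum over \<open>K\<close> is meaningful without a boundedness condition.
\<close>

definition approx_error ::
    "real set \<Rightarrow> (real \<Rightarrow> real) set \<Rightarrow> (real \<Rightarrow> real) set \<Rightarrow> ereal" where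
  "approx_error \<Omega> K \<Sigma> = (SUP f\<in>K. INF g\<in>\<Sigma>. ereal (sup_norm \<Omega> (\<lambda>x. f x - g x)))"

definition ReLU :: "real \<Rightarrow> real" where
  "ReLU t = max 0 t"

primrec hidden_layer ::
    "(nat \<Rightarrow> real mat) \<Rightarrow> (nat \<Rightarrow> real Matrix.vec) \<Rightarrow> real Matrix.vec \<Rightarrow> nat \<Rightarrow> real Matrix.vec" where
  "hidden_layer A b x 0 = x"
| "hidden_layer A b x (Suc l) =
     map_vec ReLU (A (Suc l) *\<^sub>v hidden_layer A b x l + b (Suc l))"

definition network_output ::
    "(nat \<Rightarrow> real mat) \<Rightarrow> (nat \<Rightarrow> real Matrix.vec) \<Rightarrow> nat \<Rightarrow> real Matrix.vec \<Rightarrow> real Matrix.vec" where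
  "network_output A b L x = A (L + 1) *\<^sub>v hidden_layer A b x L + b (L + 1)"

text \<open>Layer \<open>0\<close> is the scalar input, layer \<open>L + 1\<close> the scalar output.\<close>

definition layer_width :: "nat \<Rightarrow> nat \<Rightarrow> nat \<Rightarrow> nat" where
  "layer_width W L l = (if 1 \<le> l \<and> l \<le> L then W else 1)"

definition Upsilon_ReLU :: "nat \<Rightarrow> nat \<Rightarrow> (real \<Rightarrow> real) set" where
  "Upsilon_ReLU W L =
    {f. \<exists>A b.
      (\<forall>l\<in>{1..L + 1}. A l \<in> carrier_mat (layer_width W L l) (layer_width W L (l - 1)) \<and>
                     b l \<in> carrier_vec (layer_width W L l)) \<and>
      (\<forall>t. f t = vec_index (network_output A b L (Matrix.vec 1 (\<lambda>_. t))) 0)}"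

end

theory Submission
  imports Defs
begin

text \<open>
  A network with a number of parameters of order \<open>n\<close> reaches the accuracy of a grid with
  \<open>n\<^sup>2\<close> points because a single real weight can store \<open>n\<close> bits, which \<open>O(n)\<close> layers of
  bounded width can read back one after the other.

  Put \<open>w = 1/n\<close> and \<open>h = 1/n\<^sup>2\<close>. On each coarse interval starting at \<open>j w\<close> the function \<open>f\<close>
  is followed by a walk that starts at \<open>f (j w)\<close> and moves with slope \<open>1\<close> or \<open>-1\<close> on each of the
  \<open>n\<close> fine intervals of length \<open>h\<close>; choosing the signs greedily keeps the walk within \<open>h\<close> of \<open>f\<close>
  at the fine grid points (\<open>walk_signs_exist\<close>). The \<open>n\<close> signs are the ternary digits, \<open>0\<close> or \<open>2\<close>,
  of one number. The network first evaluates continuous staircases that deliver, for the current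
  \<open>j\<close>, the node \<open>j w\<close>, the value \<open>f (j w)\<close> and the code of the signs
  (\<open>hidden_neurons_staircase\<close>), and then extracts the digits and adds up the walk
  (\<open>hidden_neurons_selected_ramps\<close>, \<open>selected_ramps_eq\<close>).

  A continuous staircase must climb somewhere. Here it climbs on the intervals of length \<open>h\<close> just
  to the left of the nodes, where the extracted digits mean nothing. To repair this, the output is
  clamped, for each of the nodes \<open>p = w, 2 w, \<dots>, 1\<close>, to the interval of radius \<open>\<bar>t - p\<bar>\<close> about
  \<open>f p\<close>. Since \<open>f\<close> is \<open>1\<close>-Lipschitz, \<open>f t\<close> lies in that interval: clamping never increases the error, and at distance at
  most \<open>h\<close> from a node it leaves an error of at most \<open>2 h\<close> (\<open>pinned_mono\<close>, \<open>pinned_near_node\<close>).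

  The three phases need \<open>2 n\<close>, \<open>3 n\<close> and \<open>3 n\<close> hidden layers, and three further layers
  supply their inputs. Layers that only pass the result on bring the depth to \<open>16 n + 2\<close>. The resulting error is at most \<open>3 / n\<^sup>2\<close>.
\<close>

section \<open>Layer-by-layer construction of networks\<close>

text \<open>
  What the next layer can compute before its activation. Closure under pointwise sums and multiples
  lets membership be read off from the shape of an expression, without naming weights.
\<close>

inductive_set affine_span :: "(real \<Rightarrow> real) set \<Rightarrow> (real \<Rightarrow> real) set"
  for S :: "(real \<Rightarrow> real) set" where
  member: "s \<in> S \<Longrightarrow> (\<lambda>t. s t) \<in> affine_span S"
| const: "(\<lambda>t. a) \<in> affine_span S"
| add: "f \<in> affine_span S \<Longrightarrow> g \<in> affine_span S \<Longrightarrow> (\<lambda>t. f t + g t) \<in> affine_span S"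
| scale: "f \<in> affine_span S \<Longrightarrow> (\<lambda>t. a * f t) \<in> affine_span S"

lemma affine_span_diff:
  assumes "f \<in> affine_span S" "g \<in> affine_span S"
  shows "(\<lambda>t. f t - g t) \<in> affine_span S"
proof -
  have "(\<lambda>t. f t + (- 1) * g t) \<in> affine_span S"
    by (intro affine_span.add affine_span.scale assms)
  then show ?thesis by simp
qed

lemma affine_span_divide:
  assumes "f \<in> affine_span S"
  shows "(\<lambda>t. f t / a) \<in> affine_span S"
  using affine_span.scale[OF assms, of "1 / a"] by simp

lemmas affine_span_intros =
  affine_span_diff affine_span_divide affine_span.add affine_span.scale affine_span.const
  affine_span.member

text \<open>
  Equality is only required on the domain \<open>D\<close>. This is what makes it possible to pass a quantity on
  unchanged: \<open>ReLU\<close> is the identity on functions that are nonnegative on \<open>D\<close>.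
\<close>

definition relu_span :: "real set \<Rightarrow> (real \<Rightarrow> real) set \<Rightarrow> (real \<Rightarrow> real) set" where
  "relu_span D S = {g. \<exists>h\<in>affine_span S. \<forall>t\<in>D. g t = ReLU (h t)}"

lemma relu_spanI: "h \<in> affine_span S \<Longrightarrow> (\<lambda>t. ReLU (h t)) \<in> relu_span D S"
  by (auto simp: relu_span_def)

lemma relu_span_const: "0 \<le> a \<Longrightarrow> (\<lambda>t. a) \<in> relu_span D S"
  using affine_span.const[of a S] by (force simp: relu_span_def ReLU_def)

lemma relu_span_carry: "s \<in> S \<Longrightarrow> (\<And>t. t \<in> D \<Longrightarrow> 0 \<le> s t) \<Longrightarrow> s \<in> relu_span D S"
  using affine_span.member[of s S] by (force simp: relu_span_def ReLU_def)

lemma relu_span_superset: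
  "S' \<subseteq> S \<Longrightarrow> (\<And>s t. s \<in> S' \<Longrightarrow> t \<in> D \<Longrightarrow> 0 \<le> s t) \<Longrightarrow> S' \<subseteq> relu_span D S"
  by (auto intro: relu_span_carry)

text \<open>
  A set of functions stands for the contents of layer \<open>L\<close>: each of them is, on \<open>D\<close>, the output of
  some neuron. This leaves the order of the neurons open and allows idle ones.
\<close>

definition hidden_neurons :: "nat \<Rightarrow> real set \<Rightarrow> nat \<Rightarrow> (real \<Rightarrow> real) set \<Rightarrow> bool" where
  "hidden_neurons W D L S \<longleftrightarrow>
    (\<exists>A b.
      (\<forall>l\<in>{1..L}. A l \<in> carrier_mat W (layer_width W L (l - 1)) \<and> b l \<in> carrier_vec W) \<and>
      (\<forall>s\<in>S. \<exists>i<layer_width W L L. \<forall>t\<in>D.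
        vec_index (hidden_layer A b (Matrix.vec 1 (\<lambda>_. t)) L) i = s t))"

lemma hidden_neurons_input: "hidden_neurons W D 0 {\<lambda>t. t}"
  by (simp add: hidden_neurons_def layer_width_def)

lemma hidden_layer_cong:
  assumes "\<And>l. 1 \<le> l \<Longrightarrow> l \<le> L \<Longrightarrow> A' l = A l \<and> b' l = b l"
  shows "hidden_layer A' b' x L = hidden_layer A b x L"
  using assms by (induction L) auto

lemma hidden_layer_carrier:
  assumes "\<forall>l\<in>{1..L}. A l \<in> carrier_mat W (layer_width W L (l - 1)) \<and> b l \<in> carrier_vec W"
  shows "hidden_layer A b (Matrix.vec 1 (\<lambda>_. t)) L \<in> carrier_vec (layer_width W L L)"
proof (cases L)
  case 0
  then show ?thesis by (simp add: layer_width_def)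
next
  case (Suc k)
  then have "L \<in> {1..L}" by simp
  then have "b L \<in> carrier_vec W"
    using assms by blast
  then have "dim_vec (b (Suc k)) = W" using Suc by simp
  then show ?thesis using Suc by (intro carrier_vecI) (simp add: layer_width_def)
qed

text \<open>
  Translates membership back into weights: each generator is picked out of the layer by a unit
  vector, and row vectors and biases combine in the same way as the functions.
\<close>

lemma affine_span_row:
  assumes "h \<in> affine_span S"
    and "\<forall>s\<in>S. \<exists>i<w. \<forall>t\<in>D. vec_index (X t) i = s t"
    and "\<And>t. X t \<in> carrier_vec w"
  shows "\<exists>r a. r \<in> carrier_vec w \<and> (\<forall>t\<in>D. h t = r \<bullet> X t + a)"
  using assms(1)
proof (induction rule: affine_span.induct)
  case (member s)
  then obtain i where i: "i < w" "\<forall>t\<in>D. vec_index (X t) i = s t" using assms(2) by blast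
  then have "\<forall>t\<in>D. s t = unit_vec w i \<bullet> X t + 0"
    using assms(3) by simp
  then show ?case using unit_vec_carrier by blast
next
  case (const a)
  have "\<forall>t\<in>D. a = 0\<^sub>v w \<bullet> X t + a" using assms(3) by simp
  then show ?case using zero_carrier_vec by blast
next
  case (add f g)
  then obtain r a r' a' where
    "r \<in> carrier_vec w" "\<forall>t\<in>D. f t = r \<bullet> X t + a"
    "r' \<in> carrier_vec w" "\<forall>t\<in>D. g t = r' \<bullet> X t + a'" by blast
  then have "r + r' \<in> carrier_vec w" "\<forall>t\<in>D. f t + g t = (r + r') \<bullet> X t + (a + a')"
    using assms(3) by (auto simp: add_scalar_prod_distrib[of _ w])
  then show ?case by blast
next
  case (scale f c)
  then obtain r a where
    "r \<in> carrier_vec w" "\<forall>t\<in>D. f t = r \<bullet> X t + a" by blast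
  then have "c \<cdot>\<^sub>v r \<in> carrier_vec w" "\<forall>t\<in>D. c * f t = (c \<cdot>\<^sub>v r) \<bullet> X t + c * a"
    using assms(3) by (auto simp: smult_scalar_prod_distrib[of _ w] distrib_left)
  then show ?case by blast
qed

text \<open>
  The one place where a layer is assembled from matrices. The functions in \<open>T\<close> occupy the first
  \<open>card T\<close> rows; the remaining rows are zero, so every layer has exactly width \<open>W\<close>.
\<close>

lemma hidden_neurons_Suc:
  assumes S: "hidden_neurons W D L S"
    and "finite T" "card T \<le> W"
    and T: "T \<subseteq> relu_span D S"
  shows "hidden_neurons W D (Suc L) T"
proof -
  obtain A b where
    dims: "\<forall>l\<in>{1..L}. A l \<in> carrier_mat W (layer_width W L (l - 1)) \<and> b l \<in> carrier_vec W"
    and vals: "\<forall>s\<in>S. \<exists>i<layer_width W L L. \<forall>t\<in>D.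
        vec_index (hidden_layer A b (Matrix.vec 1 (\<lambda>_. t)) L) i = s t"
    using S unfolding hidden_neurons_def by blast
  define w where "w = layer_width W L L"
  define X where "X t = hidden_layer A b (Matrix.vec 1 (\<lambda>_. t)) L" for t :: real
  have X: "X t \<in> carrier_vec w" for t
    unfolding X_def w_def by (rule hidden_layer_carrier[OF dims])
  have "\<exists>r a. r \<in> carrier_vec w \<and> (\<forall>t\<in>D. g t = ReLU (r \<bullet> X t + a))" if g: "g \<in> T" for g
  proof -
    obtain h where h: "h \<in> affine_span S" "\<forall>t\<in>D. g t = ReLU (h t)" using T g unfolding relu_span_def by blast
    show ?thesis
      using affine_span_row[OF h(1) vals[folded X_def w_def] X] h(2) by metis
  qed
  then obtain R a where
    R: "\<And>g. g \<in> T \<Longrightarrow> R g \<in> carrier_vec w"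
    and Ra: "\<And>g t. g \<in> T \<Longrightarrow> t \<in> D \<Longrightarrow> g t = ReLU (R g \<bullet> X t + a g)"
    by metis
  obtain e where e: "bij_betw e {0..<card T} T"
    using ex_bij_betw_nat_finite[OF \<open>finite T\<close>] by blast
  define row where "row i = (if i < card T then R (e i) else 0\<^sub>v w)" for i
  have row: "row i \<in> carrier_vec w" for i
    using R bij_betwE[OF e] by (auto simp: row_def)
  define A' where "A' = A(Suc L := Matrix.mat W w (\<lambda>(i, j). vec_index (row i) j))"
  define b' where "b' = b(Suc L := Matrix.vec W (\<lambda>i. a (e i)))"
  have X': "hidden_layer A' b' (Matrix.vec 1 (\<lambda>_. t)) L = X t" for t
    unfolding X_def by (rule hidden_layer_cong) (auto simp: A'_def b'_def)
  have width: "layer_width W (Suc L) l = layer_width W L l" if "l \<le> L" for l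
    using that by (auto simp: layer_width_def)
  have "A' l \<in> carrier_mat W (layer_width W (Suc L) (l - 1)) \<and> b' l \<in> carrier_vec W"
    if "l \<in> {1..Suc L}" for l
    using dims that width[of "l - 1"] by (cases "l = Suc L") (auto simp: A'_def b'_def w_def)
  moreover have "\<exists>i<layer_width W (Suc L) (Suc L). \<forall>t\<in>D.
      vec_index (hidden_layer A' b' (Matrix.vec 1 (\<lambda>_. t)) (Suc L)) i = g t"
    if g: "g \<in> T" for g
  proof -
    obtain i where i: "i < card T" "e i = g"
      using e g unfolding bij_betw_def by (metis atLeastLessThan_iff imageE)
    then have iW: "i < W" using \<open>card T \<le> W\<close> by simp
    have "vec_index (hidden_layer A' b' (Matrix.vec 1 (\<lambda>_. t)) (Suc L)) i = g t"
      if t: "t \<in> D" for t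
    proof -
      have "Matrix.row (A' (Suc L)) i = row i"
        using iW row[of i] by (auto simp: A'_def)
      moreover have "A' (Suc L) \<in> carrier_mat W w" "b' (Suc L) \<in> carrier_vec W"
        "vec_index (b' (Suc L)) i = a g"
        using iW i by (auto simp: A'_def b'_def)
      ultimately show ?thesis
        using iW i Ra[OF g t] by (simp add: X'[unfolded One_nat_def] row_def)
    qed
    then show ?thesis using iW by (auto simp: layer_width_def)
  qed
  ultimately show ?thesis unfolding hidden_neurons_def by blast
qed

lemma Upsilon_ReLU_affine_output:
  assumes S: "hidden_neurons W D L S" and h: "h \<in> affine_span S"
  shows "\<exists>g\<in>Upsilon_ReLU W L. \<forall>t\<in>D. g t = h t"
proof -
  obtain A b where
    dims: "\<forall>l\<in>{1..L}. A l \<in> carrier_mat W (layer_width W L (l - 1)) \<and> b l \<in> carrier_vec W"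
    and vals: "\<forall>s\<in>S. \<exists>i<layer_width W L L. \<forall>t\<in>D.
        vec_index (hidden_layer A b (Matrix.vec 1 (\<lambda>_. t)) L) i = s t"
    using S unfolding hidden_neurons_def by blast
  define w where "w = layer_width W L L"
  define X where "X t = hidden_layer A b (Matrix.vec 1 (\<lambda>_. t)) L" for t :: real
  have X: "X t \<in> carrier_vec w" for t
    unfolding X_def w_def by (rule hidden_layer_carrier[OF dims])
  obtain r a where r: "r \<in> carrier_vec w" and ra: "\<forall>t\<in>D. h t = r \<bullet> X t + a"
    using affine_span_row[OF h vals[folded X_def w_def] X] by blast
  define A' where "A' = A(Suc L := Matrix.mat 1 w (\<lambda>(i, j). vec_index r j))"
  define b' where "b' = b(Suc L := Matrix.vec 1 (\<lambda>_. a))"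
  define g where "g t = vec_index (network_output A' b' L (Matrix.vec 1 (\<lambda>_. t))) 0" for t :: real
  have X': "hidden_layer A' b' (Matrix.vec 1 (\<lambda>_. t)) L = X t" for t
    unfolding X_def by (rule hidden_layer_cong) (auto simp: A'_def b'_def)
  have "A' l \<in> carrier_mat (layer_width W L l) (layer_width W L (l - 1)) \<and>
      b' l \<in> carrier_vec (layer_width W L l)" if "l \<in> {1..L + 1}" for l
    using dims that
    by (cases "l = Suc L") (auto simp: A'_def b'_def w_def layer_width_def)
  then have "g \<in> Upsilon_ReLU W L"
    unfolding Upsilon_ReLU_def g_def by blast
  moreover have "g t = h t" if t: "t \<in> D" for t
  proof -
    have "Matrix.row (A' (Suc L)) 0 = r" using r by (auto simp: A'_def)
    moreover have "A' (Suc L) \<in> carrier_mat 1 w" "b' (Suc L) \<in> carrier_vec 1"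
        "vec_index (b' (Suc L)) 0 = a"
      by (auto simp: A'_def b'_def)
    ultimately show ?thesis using ra t by (simp add: g_def network_output_def X'[unfolded One_nat_def])
  qed
  ultimately show ?thesis by blast
qed

lemma hidden_neurons_mono:
  "hidden_neurons W D L S \<Longrightarrow> T \<subseteq> S \<Longrightarrow> hidden_neurons W D L T"
  unfolding hidden_neurons_def by (elim exE conjE, intro exI conjI, assumption) blast

lemma hidden_neurons_pad:
  assumes "hidden_neurons W D L S" "finite S" "card S \<le> W"
    and "\<And>s t. s \<in> S \<Longrightarrow> t \<in> D \<Longrightarrow> 0 \<le> s t"
  shows "hidden_neurons W D (L + k) S"
proof (induction k)
  case (Suc k)
  have "hidden_neurons W D (Suc (L + k)) S"
    using Suc assms(2,3) by (rule hidden_neurons_Suc) (use assms(4) in \<open>auto intro: relu_span_carry\<close>)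
  then show ?case by simp
qed (use assms(1) in simp)

text \<open>
  The layers below are written as nested insertions, and this rule peels off one insertion at a
  time. Only an upper bound on the number of neurons matters, so coinciding elements do no harm.
\<close>

lemma card_insert_add_le:
  assumes "card S + Suc k \<le> W"
  shows "card (insert a S) + k \<le> W"
  using assms card_insert_le_m1[of "Suc (card S)" S a] by simp

lemma card_le_add_0: "card S + 0 \<le> W \<Longrightarrow> card S \<le> W" for W :: nat
  by simp

lemma ReLU_nonneg [simp]: "0 \<le> ReLU t"
  by (simp add: ReLU_def)

lemma ReLU_of_nonneg [simp]: "0 \<le> t \<Longrightarrow> ReLU t = t"
  by (simp add: ReLU_def)

lemma ReLU_of_nonpos [simp]: "t \<le> 0 \<Longrightarrow> ReLU t = 0"
  by (simp add: ReLU_def)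

section \<open>Staircases\<close>

text \<open>
The ramp climbs from \<open>0\<close> to \<open>1\<close> on the interval from \<open>p - \<delta>\<close> to \<open>p\<close>.
\<close>

definition ramp :: "real \<Rightarrow> real \<Rightarrow> real \<Rightarrow> real" where
  "ramp \<delta> p t = (ReLU (t - (p - \<delta>)) - ReLU (t - p)) / \<delta>"

text \<open>
  Away from the climbing intervals this function has the value \<open>c j\<close> between \<open>j w\<close> and
  \<open>(j + 1) w\<close>, for \<open>j \<le> m\<close>. The partial sums of the jumps are values of \<open>c\<close> there; for
  a nonnegative sequence the activation around each partial sum therefore changes nothing on the flat pieces.
\<close>

primrec staircase :: "real \<Rightarrow> real \<Rightarrow> (nat \<Rightarrow> real) \<Rightarrow> nat \<Rightarrow> real \<Rightarrow> real" where
  "staircase w \<delta> c 0 = (\<lambda>t. c 0)"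
| "staircase w \<delta> c (Suc m) =
    (\<lambda>t. ReLU (staircase w \<delta> c m t + (c (Suc m) - c m) * ramp \<delta> (real (Suc m) * w) t))"

lemma staircase_nonneg: "0 \<le> c 0 \<Longrightarrow> 0 \<le> staircase w \<delta> c m t"
  by (cases m) simp_all

lemma staircase_flat:
  assumes "0 < \<delta>" "0 \<le> w" and c: "\<And>k. 0 \<le> c k"
    and t: "real j * w \<le> t" "t \<le> real (Suc j) * w - \<delta>"
  shows "staircase w \<delta> c m t = c (min m j)"
proof (induction m)
  case (Suc m)
  show ?case
  proof (cases "m < j")
    case True
    then have "real (Suc m) * w \<le> real j * w"
      using \<open>0 \<le> w\<close> by (intro mult_right_mono) auto
    then have "ramp \<delta> (real (Suc m) * w) t = 1"
      using t \<open>0 < \<delta>\<close> by (simp add: ramp_def)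
    then show ?thesis using Suc True c[of "Suc m"] by (simp add: min_def)
  next
    case False
    then have "real (Suc j) * w \<le> real (Suc m) * w"
      using \<open>0 \<le> w\<close> by (intro mult_right_mono) auto
    then have "ramp \<delta> (real (Suc m) * w) t = 0"
      using t \<open>0 < \<delta>\<close> by (simp add: ramp_def)
    then show ?thesis using Suc False c[of j] by (simp add: min_def)
  qed
qed simp

text \<open>
  Two layers per step: one computes the two kinks of the ramp, one adds the ramp to the partial
  sums. All staircases share the same ramp, so each costs one neuron; the other three neurons hold
  the input and the two kinks.
\<close>

lemma hidden_neurons_staircase:
  assumes "finite C" "card C + 3 \<le> W" and c: "\<And>c. c \<in> C \<Longrightarrow> 0 \<le> c 0" and D: "D \<subseteq> {0..}"
  shows "hidden_neurons W D (Suc (2 * m)) (insert (\<lambda>t. t) ((\<lambda>c. staircase w \<delta> c m) ` C))"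
proof -
  have card: "card ((\<lambda>c. staircase w \<delta> c m) ` C) + 3 \<le> W" for m
    using card_image_le[OF \<open>finite C\<close>, of "\<lambda>c. staircase w \<delta> c m"] assms(2) by linarith
  have id: "0 \<le> t" if "t \<in> D" for t using D that by auto
  show ?thesis
  proof (induction m)
    case 0
    have "insert (\<lambda>t. t) ((\<lambda>c. staircase w \<delta> c 0) ` C) \<subseteq> relu_span D {\<lambda>t. t}"
      using c id by (auto intro: relu_span_const relu_span_carry)
    moreover have "card (insert (\<lambda>t. t) ((\<lambda>c. staircase w \<delta> c 0) ` C)) \<le> W"
      by (rule card_le_add_0, rule card_insert_add_le) (use card[of 0] in linarith)
    ultimately show ?case
      using hidden_neurons_Suc[OF hidden_neurons_input] \<open>finite C\<close> by simp
  next
    case (Suc m)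
    define p where "p = real (Suc m) * w"
    let ?S = "(\<lambda>c. staircase w \<delta> c m) ` C"
    let ?M = "insert (\<lambda>t. t) (insert (\<lambda>t. ReLU (t - (p - \<delta>))) (insert (\<lambda>t. ReLU (t - p)) ?S))"
    have "hidden_neurons W D (Suc (Suc (2 * m))) ?M"
    proof (rule hidden_neurons_Suc[OF Suc])
      show "finite ?M" using \<open>finite C\<close> by simp
      show "card ?M \<le> W"
        by (rule card_le_add_0, (rule card_insert_add_le)+) (use card[of m] in linarith)
      show "?M \<subseteq> relu_span D (insert (\<lambda>t. t) ?S)"
      proof (intro insert_subsetI)
        show "?S \<subseteq> relu_span D (insert (\<lambda>t. t) ?S)"
          by (rule relu_span_superset) (auto intro: staircase_nonneg c)
      qed (rule relu_spanI affine_span_intros relu_span_carry | simp add: id)+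
    qed
    then have "hidden_neurons W D (Suc (Suc (Suc (2 * m))))
        (insert (\<lambda>t. t) ((\<lambda>c. staircase w \<delta> c (Suc m)) ` C))"
    proof (rule hidden_neurons_Suc)
      show "finite (insert (\<lambda>t. t) ((\<lambda>c. staircase w \<delta> c (Suc m)) ` C))"
        using \<open>finite C\<close> by simp
      show "card (insert (\<lambda>t. t) ((\<lambda>c. staircase w \<delta> c (Suc m)) ` C)) \<le> W"
        by (rule card_le_add_0, rule card_insert_add_le) (use card[of "Suc m"] in linarith)
      have "staircase w \<delta> c (Suc m) \<in> relu_span D ?M" if "c \<in> C" for c
        unfolding staircase.simps ramp_def p_def[symmetric]
        by (rule relu_spanI affine_span_intros | simp add: that)+
      then show "insert (\<lambda>t. t) ((\<lambda>c. staircase w \<delta> c (Suc m)) ` C) \<subseteq> relu_span D ?M"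
        using id by (auto intro: relu_span_carry simp del: staircase.simps)
    qed
    then show ?case by simp
  qed
qed

section \<open>Reading signs out of a single real number\<close>

text \<open>
  The digits of the code are \<open>2 b i\<close> with \<open>b i\<close> equal to \<open>0\<close> or \<open>1\<close>, so codes lie in the Cantor
  set: they are at most \<open>1/3\<close> or at least \<open>2/3\<close> according to the leading bit. Because of this gap
  the leading bit is a continuous function of the code whose slope does not depend on the length.
\<close>

primrec ternary :: "(nat \<Rightarrow> real) \<Rightarrow> nat \<Rightarrow> nat \<Rightarrow> real" where
  "ternary b 0 i = 0"
| "ternary b (Suc k) i = (2 * b i + ternary b k (Suc i)) / 3"

text \<open>
The jump of this function takes place inside the gap from \<open>1/3\<close> to \<open>2/3\<close>.
\<close>

definition top_digit :: "real \<Rightarrow> real" where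
  "top_digit y = ReLU (3 * y - 1) - ReLU (3 * y - 2)"

lemma ternary_bounds:
  assumes "\<forall>i. b i = 0 \<or> b i = 1"
  shows "0 \<le> ternary b k i \<and> ternary b k i \<le> 1"
proof (induction k arbitrary: i)
  case (Suc k)
  show ?case using Suc[of "Suc i"] assms[rule_format, of i] by auto
qed simp

lemma top_digit_ternary:
  assumes "\<forall>i. b i = 0 \<or> b i = 1"
  shows "top_digit (ternary b (Suc k) i) = b i"
  using assms[rule_format, of i] ternary_bounds[OF assms, of k "Suc i"] by (auto simp: top_digit_def)

text \<open>
  The code after the removal of its first \<open>i\<close> digits. For inputs at which \<open>y\<close> is not a code, the
  activation still keeps the value nonnegative, so that it can be passed on.
\<close>

primrec shifted_code :: "(real \<Rightarrow> real) \<Rightarrow> nat \<Rightarrow> real \<Rightarrow> real" where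
  "shifted_code y 0 = y"
| "shifted_code y (Suc i) =
    (\<lambda>t. ReLU (3 * shifted_code y i t - 2 * top_digit (shifted_code y i t)))"

text \<open>
The part of \<open>s\<close> that falls into the \<open>i\<close>-th fine interval, of length \<open>h\<close>.
\<close>

definition fine_ramp :: "real \<Rightarrow> nat \<Rightarrow> real \<Rightarrow> real" where
  "fine_ramp h i s = ReLU (s - real i * h) - ReLU (s - real (Suc i) * h)"

text \<open>
  A product of a bit \<open>\<beta>\<close> and a number \<open>v\<close> between \<open>0\<close> and \<open>h\<close> is not affine, but it equals
  \<open>ReLU (v + h \<beta> - h)\<close>. Adding only the ramps with bit \<open>1\<close> keeps the running sum nonnegative;
  the signed sum is recovered at the end as twice this sum minus the sum of all ramps.
\<close>

primrec selected_ramps :: "real \<Rightarrow> (real \<Rightarrow> real) \<Rightarrow> (real \<Rightarrow> real) \<Rightarrow> nat \<Rightarrow> real \<Rightarrow> real" where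
  "selected_ramps h y r 0 = (\<lambda>t. 0)"
| "selected_ramps h y r (Suc i) = (\<lambda>t. selected_ramps h y r i t +
    ReLU (fine_ramp h i (r t) + h * top_digit (shifted_code y i t) - h))"

lemma shifted_code_ternary:
  assumes b: "\<forall>i. b i = 0 \<or> b i = 1" and "y t = ternary b n 0" and "i \<le> n"
  shows "shifted_code y i t = ternary b (n - i) i"
  using \<open>i \<le> n\<close>
proof (induction i)
  case (Suc i)
  then have n: "n - i = Suc (n - Suc i)" by simp
  have code: "shifted_code y i t = ternary b (Suc (n - Suc i)) i"
    using Suc.IH Suc.prems unfolding n by simp
  have "top_digit (shifted_code y i t) = b i"
    unfolding code by (rule top_digit_ternary[OF b])
  moreover have "3 * shifted_code y i t = 2 * b i + ternary b (n - Suc i) (Suc i)"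
    unfolding code by simp
  moreover have "0 \<le> ternary b (n - Suc i) (Suc i)" using ternary_bounds[OF b] by blast
  ultimately show ?case by simp
qed (use assms(2) in simp)

lemma fine_ramp_bounds:
  assumes "0 \<le> h"
  shows "0 \<le> fine_ramp h i s \<and> fine_ramp h i s \<le> h"
  using assms by (auto simp: fine_ramp_def ReLU_def algebra_simps)

lemma selected_ramps_eq:
  assumes b: "\<forall>i. b i = 0 \<or> b i = 1" and y: "y t = ternary b n 0" and "0 \<le> h" "m \<le> n"
  shows "selected_ramps h y r m t = (\<Sum>i<m. b i * fine_ramp h i (r t))"
  using \<open>m \<le> n\<close>
proof (induction m)
  case (Suc m)
  have "shifted_code y m t = ternary b (Suc (n - Suc m)) m"
    using shifted_code_ternary[of b y t n m, OF b y] Suc.prems by (simp add: Suc_diff_Suc)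
  then have "top_digit (shifted_code y m t) = b m"
    by (simp only: top_digit_ternary[OF b])
  moreover have "ReLU (fine_ramp h m (r t) + h * b m - h) = b m * fine_ramp h m (r t)"
    using b[rule_format, of m] fine_ramp_bounds[OF \<open>0 \<le> h\<close>, of m "r t"] by auto
  ultimately show ?case using Suc by simp
qed simp

lemma shifted_code_nonneg:
  "(\<And>t. t \<in> D \<Longrightarrow> 0 \<le> y t) \<Longrightarrow> t \<in> D \<Longrightarrow> 0 \<le> shifted_code y i t"
  by (cases i) simp_all

lemma selected_ramps_nonneg: "0 \<le> selected_ramps h y r i t"
  by (induction i) simp_all

text \<open>
  Three layers per digit: one for the kinks that make up the leading bit and the fine ramp, one for
  the shifted code and the product of bit and ramp, one for the addition.
\<close>

lemma hidden_neurons_selected_ramps: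
  assumes start: "hidden_neurons W D L (insert r (insert y (insert (\<lambda>t. 0) S)))"
    and "finite S" "card S + 7 \<le> W"
    and S: "\<And>s t. s \<in> S \<Longrightarrow> t \<in> D \<Longrightarrow> 0 \<le> s t"
    and r: "\<And>t. t \<in> D \<Longrightarrow> 0 \<le> r t" and y: "\<And>t. t \<in> D \<Longrightarrow> 0 \<le> y t"
  shows "hidden_neurons W D (L + 3 * i)
    (insert r (insert (shifted_code y i) (insert (selected_ramps h y r i) S)))"
proof (induction i)
  case (Suc i)
  let ?y = "shifted_code y i" and ?P = "selected_ramps h y r i"
  let ?q = "\<lambda>t. ReLU (fine_ramp h i (r t) + h * top_digit (?y t) - h)"
  let ?S0 = "insert r (insert ?y (insert ?P S))"
  let ?S1 = "insert (\<lambda>t. ReLU (3 * ?y t - 1)) (insert (\<lambda>t. ReLU (3 * ?y t - 2))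
    (insert (\<lambda>t. ReLU (r t - real i * h)) (insert (\<lambda>t. ReLU (r t - real (Suc i) * h)) ?S0)))"
  let ?S2 = "insert r (insert (shifted_code y (Suc i)) (insert ?P (insert ?q S)))"
  let ?S3 = "insert r (insert (shifted_code y (Suc i)) (insert (selected_ramps h y r (Suc i)) S))"
  note nonneg = r shifted_code_nonneg[OF y] selected_ramps_nonneg S
  have "hidden_neurons W D (Suc (L + 3 * i)) ?S1"
  proof (rule hidden_neurons_Suc[OF Suc])
    show "finite ?S1" using \<open>finite S\<close> by simp
    show "card ?S1 \<le> W"
      by (rule card_le_add_0, (rule card_insert_add_le)+) (use assms(3) in linarith)
    have "?S0 \<subseteq> relu_span D ?S0"
      by (rule relu_span_superset) (auto simp: nonneg)
    then have "r \<in> relu_span D ?S0" "?y \<in> relu_span D ?S0" "?P \<in> relu_span D ?S0" "S \<subseteq> relu_span D ?S0"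
      by simp_all
    then show "?S1 \<subseteq> relu_span D ?S0"
      by (intro insert_subsetI) (rule relu_spanI affine_span_intros | simp)+
  qed
  then have "hidden_neurons W D (Suc (Suc (L + 3 * i))) ?S2"
  proof (rule hidden_neurons_Suc)
    show "finite ?S2" using \<open>finite S\<close> by simp
    show "card ?S2 \<le> W"
      by (rule card_le_add_0, (rule card_insert_add_le)+) (use assms(3) in linarith)
    have "insert r (insert ?P S) \<subseteq> relu_span D ?S1"
      by (rule relu_span_superset) (auto simp: nonneg)
    moreover have "?q \<in> relu_span D ?S1"
      unfolding fine_ramp_def top_digit_def
      by (rule relu_spanI affine_span_intros | simp)+
    moreover have "shifted_code y (Suc i) \<in> relu_span D ?S1"
      unfolding shifted_code.simps top_digit_def
      by (rule relu_spanI affine_span_intros | simp)+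
    ultimately show "?S2 \<subseteq> relu_span D ?S1" by blast
  qed
  then have "hidden_neurons W D (Suc (Suc (Suc (L + 3 * i)))) ?S3"
  proof (rule hidden_neurons_Suc)
    show "finite ?S3" using \<open>finite S\<close> by simp
    show "card ?S3 \<le> W"
      by (rule card_le_add_0, (rule card_insert_add_le)+) (use assms(3) in linarith)
    have "insert r (insert (shifted_code y (Suc i)) S) \<subseteq> relu_span D ?S2"
      by (rule relu_span_superset) (auto simp: nonneg simp del: shifted_code.simps)
    moreover have "(\<lambda>t. ReLU (?P t + ?q t)) \<in> relu_span D ?S2"
      by (intro relu_spanI affine_span.add affine_span.member) simp_all
    then have "selected_ramps h y r (Suc i) \<in> relu_span D ?S2"
      by (simp add: selected_ramps_nonneg)
    ultimately show "?S3 \<subseteq> relu_span D ?S2" by blast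
  qed
  moreover have "L + 3 * Suc i = Suc (Suc (Suc (L + 3 * i)))" by simp
  ultimately show ?case by metis
qed (use start in simp)

section \<open>Tracking a Lipschitz function by a walk of constant step size\<close>

text \<open>
  The direction is chosen by comparison with the next target value. If the walk is within \<open>h\<close> of its
  target, the next target is at most \<open>2 h\<close> away, and a step of size \<open>h\<close> towards it restores the
  distance \<open>h\<close>.
\<close>

primrec greedy_walk :: "real \<Rightarrow> (nat \<Rightarrow> real) \<Rightarrow> nat \<Rightarrow> real" where
  "greedy_walk h a 0 = a 0"
| "greedy_walk h a (Suc i) =
    greedy_walk h a i + (if greedy_walk h a i < a (Suc i) then h else - h)"

lemma greedy_walk_close:
  assumes "\<forall>i. \<bar>a (Suc i) - a i\<bar> \<le> h"
  shows "\<bar>greedy_walk h a k - a k\<bar> \<le> h"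
proof (induction k)
  case 0
  show ?case using assms[rule_format, of 0] by simp
next
  case (Suc k)
  then show ?case using assms[rule_format, of k] by (simp add: abs_le_iff)
qed

lemma walk_signs_exist:
  fixes a :: "nat \<Rightarrow> real"
  assumes "\<forall>i. \<bar>a (Suc i) - a i\<bar> \<le> h"
  shows "\<exists>b. (\<forall>i. b i = 0 \<or> b i = (1 :: real)) \<and>
    (\<forall>k. \<bar>a 0 + (\<Sum>i<k. (2 * b i - 1) * h) - a k\<bar> \<le> h)"
proof -
  define b where "b i = (if greedy_walk h a i < a (Suc i) then 1 else 0 :: real)" for i
  have "greedy_walk h a k = a 0 + (\<Sum>i<k. (2 * b i - 1) * h)" for k
    by (induction k) (simp_all add: b_def)
  then have "\<forall>k. \<bar>a 0 + (\<Sum>i<k. (2 * b i - 1) * h) - a k\<bar> \<le> h"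
    using greedy_walk_close[OF assms] by metis
  moreover have "\<forall>i. b i = 0 \<or> b i = 1" by (simp add: b_def)
  ultimately show ?thesis by blast
qed

lemma sum_fine_ramp:
  assumes "0 \<le> s" "s \<le> real n * h"
  shows "(\<Sum>i<n. fine_ramp h i s) = s"
  using sum_lessThan_telescope'[of "\<lambda>i. ReLU (s - real i * h)" n] assms
  by (simp add: fine_ramp_def)

text \<open>
  At a point of the \<open>k\<close>-th fine interval, the earlier ramps are complete and the later ones have
  not started. With \<open>x i\<close> as the slopes, the sum is the piecewise linear walk.
\<close>

lemma sum_signed_fine_ramp:
  assumes "0 \<le> h" "k < n" "real k * h \<le> s" "s \<le> real (Suc k) * h"
  shows "(\<Sum>i<n. x i * fine_ramp h i s) = (\<Sum>i<k. x i * h) + x k * (s - real k * h)"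
proof -
  have "fine_ramp h i s = 0" if "k < i" for i
  proof -
    have "real (Suc k) * h \<le> real i * h" "real i * h \<le> real (Suc i) * h"
      using that \<open>0 \<le> h\<close> by (auto intro!: mult_right_mono)
    then show ?thesis using assms by (simp add: fine_ramp_def)
  qed
  then have "(\<Sum>i<n. x i * fine_ramp h i s) = (\<Sum>i<Suc k. x i * fine_ramp h i s)"
    using \<open>k < n\<close> by (intro sum.mono_neutral_right) auto
  moreover have "fine_ramp h i s = h" if "i < k" for i
  proof -
    have "real (Suc i) * h \<le> real k * h" "real i * h \<le> real (Suc i) * h"
      using that \<open>0 \<le> h\<close> by (auto intro!: mult_right_mono)
    then show ?thesis using assms by (simp add: fine_ramp_def algebra_simps)
  qed
  moreover have "fine_ramp h k s = s - real k * h"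
    using assms by (simp add: fine_ramp_def)
  ultimately show ?thesis by simp
qed

section \<open>Repairing the values near the nodes\<close>

text \<open>
  For \<open>d \<ge> 0\<close> this is the projection of \<open>z\<close> onto the interval of radius \<open>d\<close> about \<open>c\<close>, written
  with two activations.
\<close>

definition clamp_around :: "real \<Rightarrow> real \<Rightarrow> real \<Rightarrow> real" where
  "clamp_around c d z = c - d + ReLU (z - (c - d)) - ReLU (z - (c + d))"

lemma clamp_around_close:
  assumes "\<bar>v - c\<bar> \<le> d"
  shows "\<bar>clamp_around c d z - v\<bar> \<le> \<bar>z - v\<bar>" "\<bar>clamp_around c d z - v\<bar> \<le> 2 * d"
  using assms by (auto simp: clamp_around_def ReLU_def)

text \<open>
  The interval for the node \<open>p\<close> has radius \<open>\<bar>t - p\<bar>\<close>, here as a sum of two activations. The nodes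
  are \<open>w, 2 w, \<dots>, m w\<close>: a staircase never climbs to the left of \<open>0\<close>.
\<close>

primrec pinned :: "(real \<Rightarrow> real) \<Rightarrow> real \<Rightarrow> (real \<Rightarrow> real) \<Rightarrow> nat \<Rightarrow> real \<Rightarrow> real" where
  "pinned f w g 0 = g"
| "pinned f w g (Suc m) = (\<lambda>t. ReLU (clamp_around (f (real (Suc m) * w))
    (ReLU (t - real (Suc m) * w) + ReLU (real (Suc m) * w - t)) (pinned f w g m t)))"

lemma lipschitz_1D: "1-lipschitz_on UNIV f \<Longrightarrow> \<bar>f x - f y\<bar> \<le> \<bar>x - y\<bar>" for f :: "real \<Rightarrow> real"
  using lipschitz_onD[of 1 UNIV f x y] by (simp add: dist_real_def)

lemma ReLU_add_ReLU_minus: "ReLU (t - p) + ReLU (p - t) = \<bar>t - p\<bar>"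
  by (simp add: ReLU_def)

text \<open>
  By the Lipschitz condition \<open>f t\<close> lies in the interval used for clamping, and it is nonnegative.
  Hence it is fixed by the clamping and by the activation, and both are contractions.
\<close>

lemma pinned_Suc_close:
  assumes f: "1-lipschitz_on UNIV f" and "0 \<le> f t"
  shows "\<bar>pinned f w g (Suc m) t - f t\<bar> \<le> \<bar>pinned f w g m t - f t\<bar>"
    and "\<bar>pinned f w g (Suc m) t - f t\<bar> \<le> 2 * \<bar>t - real (Suc m) * w\<bar>"
proof -
  define p where "p = real (Suc m) * w"
  define z where "z = clamp_around (f p) \<bar>t - p\<bar> (pinned f w g m t)"
  have "\<bar>f t - f p\<bar> \<le> \<bar>t - p\<bar>" by (rule lipschitz_1D[OF f])
  note z = clamp_around_close[OF this, of "pinned f w g m t", folded z_def]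
  have "pinned f w g (Suc m) t = ReLU z"
    by (simp add: z_def p_def ReLU_add_ReLU_minus del: of_nat_Suc)
  moreover have "\<bar>ReLU z - f t\<bar> \<le> \<bar>z - f t\<bar>"
    using \<open>0 \<le> f t\<close> by (simp add: ReLU_def)
  ultimately show "\<bar>pinned f w g (Suc m) t - f t\<bar> \<le> \<bar>pinned f w g m t - f t\<bar>"
    and "\<bar>pinned f w g (Suc m) t - f t\<bar> \<le> 2 * \<bar>t - real (Suc m) * w\<bar>"
    using z by (simp_all only: p_def)
qed

lemma pinned_mono:
  assumes f: "1-lipschitz_on UNIV f" and "0 \<le> f t" and "k \<le> m"
  shows "\<bar>pinned f w g m t - f t\<bar> \<le> \<bar>pinned f w g k t - f t\<bar>"
  using \<open>k \<le> m\<close>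
  by (induction m rule: dec_induct)
    (use pinned_Suc_close(1)[OF f \<open>0 \<le> f t\<close>] order.trans in \<open>blast+\<close>)

lemma pinned_near_node:
  assumes f: "1-lipschitz_on UNIV f" and "0 \<le> f t" and "1 \<le> k" "k \<le> m"
  shows "\<bar>pinned f w g m t - f t\<bar> \<le> 2 * \<bar>t - real k * w\<bar>"
proof -
  obtain j where "k = Suc j" using \<open>1 \<le> k\<close> by (cases k) auto
  then show ?thesis
    using pinned_mono[OF f \<open>0 \<le> f t\<close> \<open>k \<le> m\<close>] pinned_Suc_close(2)[OF f \<open>0 \<le> f t\<close>, of w g j]
      order.trans by blast
qed

lemma pinned_nonneg:
  "(\<And>t. t \<in> D \<Longrightarrow> 0 \<le> g t) \<Longrightarrow> t \<in> D \<Longrightarrow> 0 \<le> pinned f w g m t"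
  by (cases m) simp_all

text \<open>
  Three layers per node: the two halves of \<open>\<bar>t - p\<bar>\<close>, the two activations of the clamping, and
  the result.
\<close>

lemma hidden_neurons_pinned:
  assumes start: "hidden_neurons W D L {\<lambda>t. t, g}"
    and "5 \<le> W" and D: "D \<subseteq> {0..}" and g: "\<And>t. t \<in> D \<Longrightarrow> 0 \<le> g t"
  shows "hidden_neurons W D (L + 3 * m) {\<lambda>t. t, pinned f w g m}"
proof (induction m)
  case (Suc m)
  define p where "p = real (Suc m) * w"
  define c where "c = f p"
  let ?g = "pinned f w g m"
  let ?u = "\<lambda>t. ReLU (t - p)" and ?v = "\<lambda>t. ReLU (p - t)"
  let ?lo = "\<lambda>t. ReLU (?g t - (c - (?u t + ?v t)))"
  let ?hi = "\<lambda>t. ReLU (?g t - (c + (?u t + ?v t)))"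
  have id: "0 \<le> t" if "t \<in> D" for t using D that by auto
  note nonneg = id pinned_nonneg[OF g]
  have "hidden_neurons W D (Suc (L + 3 * m)) {\<lambda>t. t, ?g, ?u, ?v}"
  proof (rule hidden_neurons_Suc[OF Suc])
    show "card {\<lambda>t. t, ?g, ?u, ?v} \<le> W"
      by (rule card_le_add_0, (rule card_insert_add_le)+) (use \<open>5 \<le> W\<close> in simp)
    show "{\<lambda>t. t, ?g, ?u, ?v} \<subseteq> relu_span D {\<lambda>t. t, ?g}"
      by (intro insert_subsetI empty_subsetI)
        (rule relu_spanI affine_span_intros relu_span_carry | simp add: nonneg)+
  qed simp
  then have "hidden_neurons W D (Suc (Suc (L + 3 * m))) {\<lambda>t. t, ?u, ?v, ?lo, ?hi}"
  proof (rule hidden_neurons_Suc)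
    show "card {\<lambda>t. t, ?u, ?v, ?lo, ?hi} \<le> W"
      by (rule card_le_add_0, (rule card_insert_add_le)+) (use \<open>5 \<le> W\<close> in simp)
    show "{\<lambda>t. t, ?u, ?v, ?lo, ?hi} \<subseteq> relu_span D {\<lambda>t. t, ?g, ?u, ?v}"
    proof (intro insert_subsetI empty_subsetI)
      show "?u \<in> relu_span D {\<lambda>t. t, ?g, ?u, ?v}" "?v \<in> relu_span D {\<lambda>t. t, ?g, ?u, ?v}"
        "(\<lambda>t. t) \<in> relu_span D {\<lambda>t. t, ?g, ?u, ?v}"
        by (rule relu_span_carry; simp add: id)+
    qed (rule relu_spanI affine_span_intros | simp)+
  qed simp
  then have "hidden_neurons W D (Suc (Suc (Suc (L + 3 * m)))) {\<lambda>t. t, pinned f w g (Suc m)}"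
  proof (rule hidden_neurons_Suc)
    show "card {\<lambda>t. t, pinned f w g (Suc m)} \<le> W"
      by (rule card_le_add_0, (rule card_insert_add_le)+) (use \<open>5 \<le> W\<close> in simp)
    have "pinned f w g (Suc m) \<in> relu_span D {\<lambda>t. t, ?u, ?v, ?lo, ?hi}"
      unfolding pinned.simps clamp_around_def p_def[symmetric] c_def[symmetric]
      by (rule relu_spanI affine_span_intros | simp)+
    then show "{\<lambda>t. t, pinned f w g (Suc m)} \<subseteq> relu_span D {\<lambda>t. t, ?u, ?v, ?lo, ?hi}"
      by (auto intro: relu_span_carry simp: id simp del: pinned.simps)
  qed simp
  moreover have "L + 3 * Suc m = Suc (Suc (Suc (L + 3 * m)))" by simp
  ultimately show ?case by metis
qed (use start in simp)

section \<open>The approximating network\<close>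

text \<open>
  Nonnegativity of \<open>f\<close> allows its values to be passed on through activations. The largest layer
  carries the input, the node value, the local coordinate, the code, the running sum and four kinks,
  that is nine neurons.
\<close>

lemma network_approximation:
  fixes f :: "real \<Rightarrow> real"
  assumes f: "1-lipschitz_on UNIV f" and f_nonneg: "\<And>t. 0 \<le> f t" and n: "n \<ge> 1"
  shows "\<exists>g. hidden_neurons 11 {0..1} (16 * n + 2) {g} \<and>
    (\<forall>t\<in>{0..1}. \<bar>g t - f t\<bar> \<le> 3 / real n ^ 2)"
proof -
  define w where "w = 1 / real n"
  define h where "h = 1 / real n ^ 2"
  have w: "0 < w" "w \<le> 1" "real n * w = 1" using n by (auto simp: w_def)
  have h: "0 < h" "real n * h = w" using n by (auto simp: h_def w_def power2_eq_square)
  have "\<exists>b. (\<forall>i. b i = 0 \<or> b i = (1 :: real)) \<and>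
      (\<forall>k. \<bar>f (real j * w) + (\<Sum>i<k. (2 * b i - 1) * h) - f (real j * w + real k * h)\<bar> \<le> h)" for j
    using walk_signs_exist[of "\<lambda>i. f (real j * w + real i * h)" h]
      lipschitz_1D[OF f, of "real j * w + real (Suc i) * h" "real j * w + real i * h" for i] h(1)
    by (auto simp: algebra_simps)
  then obtain b where b: "\<And>j. \<forall>i. b j i = 0 \<or> b j i = (1 :: real)"
    and walk: "\<And>j k. \<bar>f (real j * w) + (\<Sum>i<k. (2 * b j i - 1) * h) - f (real j * w + real k * h)\<bar> \<le> h"
    by metis
  \<comment> \<open>the three staircases: node, value at the node, code of the signs\<close>
  define cJ where "cJ j = real j * w" for j
  define cF where "cF j = f (real j * w)" for j
  define cY where "cY j = ternary (b j) n 0" for j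
  have c_nonneg: "0 \<le> cJ k" "0 \<le> cF k" "0 \<le> cY k" for k
    using w f_nonneg[of "real k * w"] ternary_bounds[OF b, of k n 0]
    by (auto simp: cJ_def cF_def cY_def)
  define J where "J = staircase w h cJ n"
  define F where "F = staircase w h cF n"
  define Y where "Y = staircase w h cY n"
  \<comment> \<open>on flat pieces the coordinate relative to the node, which is also the sum of all fine ramps\<close>
  define r where "r t = ReLU (t - J t)" for t
  define P where "P = selected_ramps h Y r n"
  define raw where "raw t = ReLU (F t + 2 * P t - r t)" for t
  define g where "g = pinned f w raw n"
  have nonneg: "0 \<le> J t" "0 \<le> F t" "0 \<le> Y t" "0 \<le> r t" "0 \<le> raw t" for t
    using c_nonneg by (auto simp: J_def F_def Y_def r_def raw_def staircase_nonneg)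

  have "hidden_neurons 11 {0..1} (Suc (2 * n))
      (insert (\<lambda>t. t) ((\<lambda>c. staircase w h c n) ` {cJ, cF, cY}))"
  proof (rule hidden_neurons_staircase)
    have "card {cJ, cF, cY} \<le> 3"
      by (rule card_le_add_0, (rule card_insert_add_le)+) simp
    then show "card {cJ, cF, cY} + 3 \<le> 11" by simp
  qed (use c_nonneg in auto)
  then have "hidden_neurons 11 {0..1} (Suc (2 * n)) {\<lambda>t. t, J, F, Y}"
    by (simp add: J_def F_def Y_def)
  then have "hidden_neurons 11 {0..1} (Suc (Suc (2 * n))) {r, Y, \<lambda>t. 0, \<lambda>t. t, F}"
  proof (rule hidden_neurons_Suc)
    show "card {r, Y, \<lambda>t. 0, \<lambda>t. t, F} \<le> 11"
      by (rule card_le_add_0, (rule card_insert_add_le)+) simp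
    have "r \<in> relu_span {0..1} {\<lambda>t. t, J, F, Y}"
      unfolding r_def by (rule relu_spanI affine_span_intros | simp)+
    then show "{r, Y, \<lambda>t. 0, \<lambda>t. t, F} \<subseteq> relu_span {0..1} {\<lambda>t. t, J, F, Y}"
      by (auto intro: relu_span_const relu_span_carry simp: nonneg)
  qed simp
  then have "hidden_neurons 11 {0..1} (Suc (Suc (2 * n)) + 3 * n)
      {r, shifted_code Y n, P, \<lambda>t. t, F}"
    unfolding P_def
  proof (rule hidden_neurons_selected_ramps)
    have "card {\<lambda>t. t, F} \<le> 2"
      by (rule card_le_add_0, (rule card_insert_add_le)+) simp
    then show "card {\<lambda>t. t, F} + 7 \<le> 11" by simp
  qed (use nonneg in auto)
  then have "hidden_neurons 11 {0..1} (Suc (Suc (Suc (2 * n)) + 3 * n)) {\<lambda>t. t, raw}"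
  proof (rule hidden_neurons_Suc)
    show "card {\<lambda>t. t, raw} \<le> 11"
      by (rule card_le_add_0, (rule card_insert_add_le)+) simp
    have "raw \<in> relu_span {0..1} {r, shifted_code Y n, P, \<lambda>t. t, F}"
      unfolding raw_def by (rule relu_spanI affine_span_intros | simp)+
    then show "{\<lambda>t. t, raw} \<subseteq> relu_span {0..1} {r, shifted_code Y n, P, \<lambda>t. t, F}"
      by (auto intro: relu_span_carry)
  qed simp
  then have "hidden_neurons 11 {0..1} (Suc (Suc (Suc (2 * n)) + 3 * n) + 3 * n) {\<lambda>t. t, g}"
    unfolding g_def by (rule hidden_neurons_pinned) (use nonneg in auto)
  moreover have "Suc (Suc (Suc (2 * n)) + 3 * n) + 3 * n = 8 * n + 3" by simp
  ultimately have "hidden_neurons 11 {0..1} (8 * n + 3) {\<lambda>t. t, g}" by metis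
  then have "hidden_neurons 11 {0..1} (8 * n + 3) {g}"
    by (rule hidden_neurons_mono) simp
  then have "hidden_neurons 11 {0..1} (8 * n + 3 + (8 * n - 1)) {g}"
    by (rule hidden_neurons_pad) (auto simp: g_def nonneg intro!: pinned_nonneg[of UNIV])
  \<comment> \<open>the natural subtraction does not truncate, since \<open>n \<ge> 1\<close>\<close>
  moreover have "8 * n + 3 + (8 * n - 1) = 16 * n + 2" using n by simp
  ultimately have net: "hidden_neurons 11 {0..1} (16 * n + 2) {g}" by simp

  have "\<bar>g t - f t\<bar> \<le> 3 * h" if t: "t \<in> {0..1}" for t
  proof -
    define j where "j = nat \<lfloor>t / w\<rfloor>"
    have "real j = of_int \<lfloor>t / w\<rfloor>" using t w by (simp add: j_def)
    then have "real j \<le> t / w" "t / w < real (Suc j)" by linarith+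
    then have j: "real j * w \<le> t" "t < real (Suc j) * w"
      using w by (simp_all add: pos_le_divide_eq pos_divide_less_eq del: of_nat_Suc)
    have "real j * w \<le> real n * w" using j(1) t w by simp
    then have "j \<le> n" using w(1) by (simp only: mult_le_cancel_right_pos of_nat_le_iff)
    \<comment> \<open>the right end point, a climbing interval of the staircases, or a flat piece\<close>
    then consider "j = n" | "j < n" "real (Suc j) * w - h < t" | "j < n" "t \<le> real (Suc j) * w - h"
      by linarith
    then show ?thesis
    proof cases
      case 1
      then have "t = real n * w" using j(1) t w by simp
      then show ?thesis
        using pinned_near_node[OF f f_nonneg[of t] n order.refl, of w raw] h by (simp add: g_def)
    next
      case 2
      have "\<bar>g t - f t\<bar> \<le> 2 * \<bar>t - real (Suc j) * w\<bar>"
        unfolding g_def using 2 by (intro pinned_near_node[OF f f_nonneg[of t]]) auto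
      then show ?thesis using 2 j h by simp
    next
      case 3
      have flat: "J t = cJ j" "F t = cF j" "Y t = cY j"
        unfolding J_def F_def Y_def
        using staircase_flat[of h w _ j t n] h w c_nonneg j(1) 3 by (auto simp: min_def)
      define s where "s = t - real j * w"
      have s: "0 \<le> s" "s \<le> real n * h" "r t = s"
        using j flat(1) h by (auto simp: s_def r_def cJ_def algebra_simps)
      have P: "P t = (\<Sum>i<n. b j i * fine_ramp h i s)"
        unfolding P_def using selected_ramps_eq[of "b j" Y t n h n r, OF b] flat(3) h s(3)
        by (simp add: cY_def)
      have "2 * P t - s = (\<Sum>i<n. (2 * b j i - 1) * fine_ramp h i s)"
        unfolding P using sum_fine_ramp[OF s(1,2)]
        by (simp add: algebra_simps sum_subtractf sum_distrib_left)
      define k where "k = nat \<lfloor>s / h\<rfloor>"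
      have "real k = of_int \<lfloor>s / h\<rfloor>" using s h by (simp add: k_def)
      then have "real k \<le> s / h" "s / h < real (Suc k)" by linarith+
      then have k: "real k * h \<le> s" "s < real (Suc k) * h"
        using h by (simp_all add: pos_le_divide_eq pos_divide_less_eq del: of_nat_Suc)
      have "s < real n * h" using 3 h s_def by (simp add: algebra_simps)
      then have "real k * h < real n * h" using k(1) by simp
      then have "k < n" using h(1) by (simp only: mult_less_cancel_right_pos of_nat_less_iff)
      define walk_k where "walk_k = f (real j * w) + (\<Sum>i<k. (2 * b j i - 1) * h)"
      have sum: "F t + 2 * P t - r t = walk_k + (2 * b j k - 1) * (s - real k * h)"
        using sum_signed_fine_ramp[of h k n s "\<lambda>i. 2 * b j i - 1"] h \<open>k < n\<close> k
          \<open>2 * P t - s = _\<close> flat(2) s(3) by (simp add: walk_k_def cF_def)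
      \<comment> \<open>the walk at the fine grid point, the last partial step, and the variation of \<open>f\<close>: \<open>h\<close> each\<close>
      have "\<bar>(2 * b j k - 1) * (s - real k * h)\<bar> \<le> h"
        using b[rule_format, of j k] k by (auto simp: algebra_simps)
      moreover have "\<bar>walk_k - f (real j * w + real k * h)\<bar> \<le> h"
        unfolding walk_k_def by (rule walk)
      moreover have "\<bar>f (real j * w + real k * h) - f t\<bar> \<le> h"
        using lipschitz_1D[OF f, of "real j * w + real k * h" t] k
        by (simp add: s_def algebra_simps)
      ultimately have "\<bar>(F t + 2 * P t - r t) - f t\<bar> \<le> 3 * h"
        unfolding sum by linarith
      then have "\<bar>raw t - f t\<bar> \<le> 3 * h"
        using f_nonneg[of t] by (auto simp: raw_def ReLU_def)
      then show ?thesis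
        unfolding g_def using pinned_mono[OF f f_nonneg[of t], of 0 n w raw] by simp
    qed
  qed
  then show ?thesis using net by (auto simp: h_def)
qed

section \<open>The approximation rate\<close>

text \<open>
  Both summands of the norm are nonnegative, so each is at most \<open>1\<close>. The infimum that defines the
  seminorm is itself a Lipschitz constant because it bounds every difference quotient.
\<close>

lemma lip1_unit_ball_lipschitz_bounded:
  assumes "f \<in> lip1_unit_ball {0..1}"
  shows "1-lipschitz_on {0..1} f" and "\<And>x. x \<in> {0..1} \<Longrightarrow> \<bar>f x\<bar> \<le> 1"
proof -
  let ?I = "{0..1 :: real}"
  have cont: "continuous_on ?I f" and lip: "\<exists>M. M-lipschitz_on ?I f"
    and norm: "lip1_seminorm ?I f + sup_norm ?I f \<le> 1"
    using assms by (auto simp: lip1_unit_ball_def lip1_def lip1_norm_def)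
  have "compact ((\<lambda>x. \<bar>f x\<bar>) ` ?I)"
    by (intro compact_continuous_image continuous_intros cont compact_Icc)
  then have bdd: "bdd_above ((\<lambda>x. \<bar>f x\<bar>) ` ?I)"
    by (intro bounded_imp_bdd_above compact_imp_bounded)
  have sup: "\<bar>f x\<bar> \<le> sup_norm ?I f" if "x \<in> ?I" for x
    unfolding sup_norm_def using that bdd by (rule cSUP_upper)
  have sup0: "0 \<le> sup_norm ?I f" using sup[of 0] by simp
  have semi: "\<bar>f x - f y\<bar> \<le> lip1_seminorm ?I f * \<bar>x - y\<bar>" if "x \<in> ?I" "y \<in> ?I" for x y
  proof (cases "x = y")
    case False
    have "\<bar>f x - f y\<bar> / \<bar>x - y\<bar> \<le> lip1_seminorm ?I f"
      unfolding lip1_seminorm_def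
    proof (rule cInf_greatest)
      fix M assume "M \<in> {M. M-lipschitz_on ?I f}"
      then show "\<bar>f x - f y\<bar> / \<bar>x - y\<bar> \<le> M"
        using lipschitz_onD[of M ?I f x y] that False by (simp add: dist_real_def divide_simps)
    qed (use lip in auto)
    then show ?thesis using False by (simp add: divide_simps)
  qed simp
  have semi0: "0 \<le> lip1_seminorm ?I f"
    unfolding lip1_seminorm_def
    by (rule cInf_greatest) (use lip in \<open>auto dest: lipschitz_on_nonneg\<close>)
  show "1-lipschitz_on ?I f"
  proof (rule lipschitz_onI)
    fix x y :: real assume xy: "x \<in> ?I" "y \<in> ?I"
    have "lip1_seminorm ?I f * \<bar>x - y\<bar> \<le> 1 * \<bar>x - y\<bar>"
      using norm sup0 by (intro mult_right_mono) auto
    then show "dist (f x) (f y) \<le> 1 * dist x y"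
      using semi[OF xy] by (simp add: dist_real_def)
  qed simp
  show "\<bar>f x\<bar> \<le> 1" if "x \<in> ?I" for x
    using sup[OF that] norm semi0 by linarith
qed

theorem theorem8p11:
  fixes n :: nat
  assumes "n \<ge> 1"
  shows "approx_error {0..1} (lip1_unit_ball {0..1}) (Upsilon_ReLU 11 (16 * n + 2))
           \<le> ereal (6 / real n ^ 2)"
  unfolding approx_error_def
proof (rule SUP_least)
  fix f assume f: "f \<in> lip1_unit_ball {0..1}"
  \<comment> \<open>extended constantly beyond the interval, and shifted to become nonnegative\<close>
  define f' where "f' t = f (max 0 (min 1 t)) + 1" for t
  have "1-lipschitz_on UNIV f'"
  proof (rule lipschitz_onI)
    fix x y :: real
    have "dist (f (max 0 (min 1 x))) (f (max 0 (min 1 y))) \<le> dist (max 0 (min 1 x)) (max 0 (min 1 y))"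
      using lipschitz_onD[OF lip1_unit_ball_lipschitz_bounded(1)[OF f]] by simp
    also have "\<dots> \<le> dist x y" by (simp add: dist_real_def max_def min_def)
    finally show "dist (f' x) (f' y) \<le> 1 * dist x y" by (simp add: f'_def dist_real_def)
  qed simp
  moreover have "0 \<le> f' t" for t
    using lip1_unit_ball_lipschitz_bounded(2)[OF f, of "max 0 (min 1 t)"] by (simp add: f'_def)
  ultimately obtain g where g: "hidden_neurons 11 {0..1} (16 * n + 2) {g}"
    and close: "\<forall>t\<in>{0..1}. \<bar>g t - f' t\<bar> \<le> 3 / real n ^ 2"
    using network_approximation[of f' n] assms by blast
  have "(\<lambda>t. g t - 1) \<in> affine_span {g}"
    by (intro affine_span_diff affine_span.const affine_span.member) simp
  then obtain G where G: "G \<in> Upsilon_ReLU 11 (16 * n + 2)" "\<forall>t\<in>{0..1}. G t = g t - 1"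
    using Upsilon_ReLU_affine_output[OF g] by blast
  have "sup_norm {0..1} (\<lambda>x. f x - G x) \<le> 6 / real n ^ 2"
    unfolding sup_norm_def
  proof (rule cSUP_least)
    fix x :: real assume x: "x \<in> {0..1}"
    then have "f x - G x = f' x - g x" using G(2) by (simp add: f'_def)
    then have "\<bar>f x - G x\<bar> = \<bar>g x - f' x\<bar>" by linarith
    also have "\<dots> \<le> 3 / real n ^ 2" using close x by blast
    also have "\<dots> \<le> 6 / real n ^ 2" by (simp add: divide_right_mono)
    finally show "\<bar>f x - G x\<bar> \<le> 6 / real n ^ 2" .
  qed simp
  then show "(INF G\<in>Upsilon_ReLU 11 (16 * n + 2). ereal (sup_norm {0..1} (\<lambda>x. f x - G x)))
      \<le> ereal (6 / real n ^ 2)"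
    using G(1) by (intro INF_lower2[of G]) auto
qed

end
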